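(* Let $0<\epsilon<\frac12$, let $f:\mathcal X\times\mathcal Y\to\mathcal Z$ be a function and let $\mu$ be a probability distribution over $\mathcal X\times\mathcal Y$. Then $$\xi^\mu_\epsilon(f)-1\le\mathrm{wprt}^\mu_\epsilon(f).$$
   Context: Write $\mu_{xy}=\mu(\{(x,y)\})$, $\mu(S)=\sum_{(x,y)\in S}\mu_{xy}$, and $\mu(z)=\mu(f^{-1}(z))$ for $z\in\mathcal Z$. A rectangle is a set $R=A\times B$ with $A\subseteq\mathcal X$, $B\subseteq\mathcal Y$. The weak partition bound is the value of the linear program $$\mathrm{wprt}^\mu_\epsilon(f)=\max_{\alpha\ge0,\ \beta_{xy}\ge0}(1-\epsilon)\alpha-\beta$$ subject to $\alpha\mu(R\cap f^{-1}(z))-\beta(R)\le1$ for all rectangles $R$ and all $z\in\mathcal Z$, and $\alpha\mu_{xy}-\beta_{xy}\ge0$ for all $(x,y)$, where $\beta(R)=\sum_{(x,y)\in R}\beta_{xy}$ and $\beta=\sum_{x,y}\beta_{xy}$. Enumerate $\mathcal Z=\{z_1,\dots,z_m\}$ so that $\mu(z_1)\ge\mu(z_2)\ge\dots\ge\mu(z_m)$, and define $\xi^\mu_\epsilon(f)=\min\{j:\sum_{i=1}^{j}\mu(z_i)\ge1-\epsilon\}$. *)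

theory Defs
  imports "HOL-Probability.Probability"
begin

definition rectangles :: "('x \<times> 'y) set set" where
  "rectangles = {A \<times> B | A B. True}"

definition wprt_feasible ::
  "('x::finite \<times> 'y::finite) pmf \<Rightarrow> ('x \<times> 'y \<Rightarrow> 'z) \<Rightarrow> real \<Rightarrow> ('x \<times> 'y \<Rightarrow> real) \<Rightarrow> bool" where
  "wprt_feasible \<mu> f \<alpha> \<beta> \<longleftrightarrow>
     \<alpha> \<ge> 0 \<and> (\<forall>p. \<beta> p \<ge> 0) \<and>
     (\<forall>R\<in>rectangles. \<forall>z. \<alpha> * measure_pmf.prob \<mu> (R \<inter> f -` {z}) - (\<Sum>p\<in>R. \<beta> p) \<le> 1) \<and>
     (\<forall>p. \<alpha> * pmf \<mu> p - \<beta> p \<ge> 0)"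

definition wprt_values ::
  "('x::finite \<times> 'y::finite) pmf \<Rightarrow> real \<Rightarrow> ('x \<times> 'y \<Rightarrow> 'z) \<Rightarrow> real set" where
  "wprt_values \<mu> \<epsilon> f = {(1 - \<epsilon>) * \<alpha> - (\<Sum>p\<in>UNIV. \<beta> p) | \<alpha> \<beta>. wprt_feasible \<mu> f \<alpha> \<beta>}"

text \<open>The value of the linear program. The lemma \<open>wprt_is_max\<close> below shows that for
  \<open>\<epsilon> > 0\<close> the supremum is finite and attained, so that it is the maximum.\<close>

definition wprt ::
  "('x::finite \<times> 'y::finite) pmf \<Rightarrow> real \<Rightarrow> ('x \<times> 'y \<Rightarrow> 'z) \<Rightarrow> real" where
  "wprt \<mu> \<epsilon> f = Sup (wprt_values \<mu> \<epsilon> f)"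

definition decreasing_enumeration ::
  "('x::finite \<times> 'y::finite) pmf \<Rightarrow> ('x \<times> 'y \<Rightarrow> 'z::finite) \<Rightarrow> (nat \<Rightarrow> 'z) \<Rightarrow> bool" where
  "decreasing_enumeration \<mu> f z \<longleftrightarrow>
     bij_betw z {1..CARD('z)} UNIV \<and>
     (\<forall>i\<in>{1..CARD('z)}. \<forall>j\<in>{1..CARD('z)}. i \<le> j \<longrightarrow>
        measure_pmf.prob \<mu> (f -` {z i}) \<ge> measure_pmf.prob \<mu> (f -` {z j}))"

text \<open>The enumeration \<open>z\<close> is an argument: ties in the ordering may be broken arbitrarily.
  Its values outside \<open>{1..CARD('z)}\<close> play no role.\<close>

definition xi ::
  "('x::finite \<times> 'y::finite) pmf \<Rightarrow> real \<Rightarrow> ('x \<times> 'y \<Rightarrow> 'z::finite) \<Rightarrow> (nat \<Rightarrow> 'z) \<Rightarrow> nat" where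
  "xi \<mu> \<epsilon> f z =
     (LEAST j. j \<in> {1..CARD('z)} \<and> (\<Sum>i=1..j. measure_pmf.prob \<mu> (f -` {z i})) \<ge> 1 - \<epsilon>)"

lemma decreasing_enumeration_exists:
  fixes f :: "'x::finite \<times> 'y::finite \<Rightarrow> 'z::finite"
  shows "\<exists>z. decreasing_enumeration \<mu> f z"
proof -
  define k where "k = (\<lambda>c. - measure_pmf.prob \<mu> (f -` {c}))"
  obtain xs :: "'z list" where xs: "set xs = UNIV" "distinct xs"
    using finite_distinct_list[of "UNIV :: 'z set"] finite by blast
  define ys where "ys = sort_key k xs"
  have ys: "set ys = UNIV" "distinct ys" "sorted (map k ys)"
    using xs by (simp_all add: ys_def)
  have len: "length ys = CARD('z)"
    using distinct_card[OF ys(2)] ys(1) by simp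
  have "bij_betw (\<lambda>i. ys ! (i - 1)) {1..CARD('z)} UNIV"
  proof -
    have "bij_betw (\<lambda>i. i - 1) {1..CARD('z)} {..<CARD('z)}"
      by (rule bij_betw_byWitness[where f' = Suc]) auto
    moreover have "bij_betw ((!) ys) {..<CARD('z)} UNIV"
      using bij_betw_nth[OF ys(2)] len ys(1) by auto
    ultimately show ?thesis
      using bij_betw_trans[of "\<lambda>i. i - 1"] unfolding comp_def by blast
  qed
  moreover have "k (ys ! (i - 1)) \<le> k (ys ! (j - 1))"
    if "i \<in> {1..CARD('z)}" "j \<in> {1..CARD('z)}" "i \<le> j" for i j
    using sorted_nth_mono[OF ys(3), of "i - 1" "j - 1"] that len by auto
  ultimately have "decreasing_enumeration \<mu> f (\<lambda>i. ys ! (i - 1))"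
    by (simp add: decreasing_enumeration_def k_def)
  then show ?thesis by blast
qed

lemma wprt_zero_feasible: "wprt_feasible \<mu> f 0 (\<lambda>_. 0)"
  by (simp add: wprt_feasible_def)

lemma wprt_feasible_bound:
  assumes "wprt_feasible \<mu> (f :: 'x::finite \<times> 'y::finite \<Rightarrow> 'z) \<alpha> \<beta>"
  shows "(1 - \<epsilon>) * \<alpha> - (\<Sum>p\<in>UNIV. \<beta> p) \<le> real (CARD('x \<times> 'y)) - \<epsilon> * \<alpha>"
proof -
  have "\<alpha> * pmf \<mu> p - \<beta> p \<le> 1" for p
  proof -
    have "{p} \<in> rectangles"
      unfolding rectangles_def mem_Collect_eq by (intro exI[of _ "{fst p}"] exI[of _ "{snd p}"]) auto
    moreover have "{p} \<inter> f -` {f p} = {p}" by auto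
    ultimately show ?thesis
      using assms unfolding wprt_feasible_def
      by (auto simp: measure_pmf_single dest!: bspec[of _ _ "{p}"] spec[of _ "f p"])
  qed
  then have "(\<Sum>p\<in>UNIV. \<alpha> * pmf \<mu> p - \<beta> p) \<le> (\<Sum>p\<in>(UNIV :: ('x \<times> 'y) set). 1)"
    by (intro sum_mono)
  moreover have "(\<Sum>p\<in>UNIV. pmf \<mu> p) = 1"
    by (rule sum_pmf_eq_1) auto
  ultimately show ?thesis
    by (simp add: sum_subtractf sum_distrib_left[symmetric] algebra_simps)
qed

lemma wprt_is_max:
  fixes f :: "'x::finite \<times> 'y::finite \<Rightarrow> 'z"
  assumes "0 < \<epsilon>"
  shows "wprt \<mu> \<epsilon> f \<in> wprt_values \<mu> \<epsilon> f" and "\<And>v. v \<in> wprt_values \<mu> \<epsilon> f \<Longrightarrow> v \<le> wprt \<mu> \<epsilon> f"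
proof -
  define n where "n = real (CARD('x \<times> 'y))"
  define S where "S = {q :: real \<times> (real ^ ('x \<times> 'y)).
    wprt_feasible \<mu> f (fst q) (($) (snd q)) \<and> fst q \<le> n / \<epsilon>}"
  define g where "g = (\<lambda>q :: real \<times> (real ^ ('x \<times> 'y)). (1 - \<epsilon>) * fst q -
    (\<Sum>p\<in>UNIV. snd q $ p))"
  have "closed S"
    unfolding S_def wprt_feasible_def Ball_def
    by (intro closed_Collect_conj closed_Collect_all closed_Collect_imp closed_Collect_le
          open_Collect_const continuous_intros)
  moreover have "bounded S"
  proof -
    have "S \<subseteq> {0..n / \<epsilon>} \<times> cbox 0 (\<chi> p. n / \<epsilon>)"
    proof
      fix q assume q: "q \<in> S"
      have "snd q $ p \<le> n / \<epsilon>" for p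
      proof -
        have "snd q $ p \<le> fst q * pmf \<mu> p"
          using q by (auto simp: S_def wprt_feasible_def simp del: split_paired_All)
        also have "\<dots> \<le> fst q * 1"
          using q by (intro mult_left_mono) (auto simp: S_def wprt_feasible_def pmf_le_1)
        finally show ?thesis using q by (simp add: S_def)
      qed
      then show "q \<in> {0..n / \<epsilon>} \<times> cbox 0 (\<chi> p. n / \<epsilon>)"
        using q by (cases q) (auto simp: S_def wprt_feasible_def mem_box_cart simp del: split_paired_All)
    qed
    then show ?thesis
      by (rule bounded_subset[rotated]) (intro bounded_Times bounded_cbox bounded_closed_interval)
  qed
  ultimately have "compact S" by (simp add: compact_eq_bounded_closed)
  moreover have z: "0 \<in> S"
  proof -
    have "($) (0 :: real ^ ('x \<times> 'y)) = (\<lambda>_. 0)"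
      by (intro ext) simp
    then show ?thesis
      using wprt_zero_feasible[of \<mu> f] assms by (simp add: S_def n_def)
  qed
  moreover have "continuous_on S g"
    unfolding g_def by (intro continuous_intros)
  ultimately obtain q where q: "q \<in> S" "\<And>r. r \<in> S \<Longrightarrow> g r \<le> g q"
    using continuous_attains_sup[of S g] by blast
  have mem: "g q \<in> wprt_values \<mu> \<epsilon> f"
    using q(1) by (auto simp: S_def g_def wprt_values_def)
  have upper: "v \<le> g q" if v: "v \<in> wprt_values \<mu> \<epsilon> f" for v
  proof -
    obtain \<alpha> \<beta> where ab: "wprt_feasible \<mu> f \<alpha> \<beta>" "v = (1 - \<epsilon>) * \<alpha> - (\<Sum>p\<in>UNIV. \<beta> p)"
      using v by (auto simp: wprt_values_def)
    show ?thesis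
    proof (cases "\<alpha> \<le> n / \<epsilon>")
      case True
      then show ?thesis
        using q(2)[of "(\<alpha>, \<chi> p. \<beta> p)"] ab True by (simp add: S_def g_def vec_lambda_inverse)
    next
      case False
      then have "n < \<epsilon> * \<alpha>" using assms by (simp add: field_simps)
      then have "v \<le> 0"
        using wprt_feasible_bound[OF ab(1), of \<epsilon>] ab(2) by (simp add: n_def)
      then show ?thesis using q(2)[OF z] by (simp add: g_def)
    qed
  qed
  have "wprt \<mu> \<epsilon> f = g q"
    unfolding wprt_def using mem upper by (rule cSup_eq_maximum)
  then show "wprt \<mu> \<epsilon> f \<in> wprt_values \<mu> \<epsilon> f"
    and "\<And>v. v \<in> wprt_values \<mu> \<epsilon> f \<Longrightarrow> v \<le> wprt \<mu> \<epsilon> f"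
    using mem upper by auto
qed

end

(* Let t be the mass of the k-th heaviest preimage, k = xi. Take alpha = 1/t and choose beta so that
   alpha * mu - beta rescales mu on each preimage f^{-1}(c) to total mass min(mu(c)/t, 1).
   The value of this solution is k - (mu(z_1) + ... + mu(z_k) - (1 - eps)) / t, and by minimality of k
   the excess over 1 - eps is at most t. *)
theory Submission
  imports Defs
begin

text \<open>Here \<alpha> * \<mu> - \<beta> has density \<open>pmf \<mu> p / max t m\<close>, with m
  the mass of the preimage containing p. It is nonnegative, and it gives that preimage total mass m
  / \<open>max t m\<close>, which is at most 1.\<close>

lemma wprt_feasible_capped:
  fixes \<mu> :: "('x::finite \<times> 'y::finite) pmf" and f :: "'x \<times> 'y \<Rightarrow> 'z"
  assumes "0 < t"
  shows "wprt_feasible \<mu> f (1 / t)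
    (\<lambda>p. pmf \<mu> p * (1 / t - 1 / max t (measure_pmf.prob \<mu> (f -` {f p}))))"
    (is "wprt_feasible \<mu> f _ ?\<beta>")
proof -
  let ?m = "\<lambda>c. measure_pmf.prob \<mu> (f -` {c})"
  have nonneg: "0 \<le> ?\<beta> p" for p
    using assms by (intro mult_nonneg_nonneg) (auto intro!: divide_left_mono)
  have rect: "1 / t * measure_pmf.prob \<mu> (R \<inter> f -` {c}) - (\<Sum>p\<in>R. ?\<beta> p) \<le> 1" for R c
  proof -
    let ?A = "R \<inter> f -` {c}"
    \<comment> \<open>Points of R outside the preimage of c only add to the subtracted sum. On
      \<open>?A\<close> the value \<open>f p\<close> is c, so the second factor of
      \<open>?\<beta>\<close> is constant and leaves the sum.\<close>
    have "(\<Sum>p\<in>?A. ?\<beta> p) \<le> (\<Sum>p\<in>R. ?\<beta> p)"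
      using nonneg by (intro sum_mono2) auto
    moreover have "(\<Sum>p\<in>?A. ?\<beta> p) = measure_pmf.prob \<mu> ?A * (1 / t - 1 / max t (?m c))"
      by (simp add: measure_measure_pmf_finite sum_distrib_right)
    moreover have "measure_pmf.prob \<mu> ?A \<le> max t (?m c)"
      by (intro max.coboundedI2 measure_pmf.finite_measure_mono) auto
    then have "measure_pmf.prob \<mu> ?A / max t (?m c) \<le> 1"
      using assms by (simp add: divide_le_eq_1 less_max_iff_disj)
    ultimately show ?thesis
      by (simp add: right_diff_distrib)
  qed
  have "0 \<le> 1 / t * pmf \<mu> p - ?\<beta> p" for p
    using assms by (simp add: right_diff_distrib)
  with nonneg rect assms show ?thesis
    unfolding wprt_feasible_def by auto
qed

text \<open>The capped solution has this value: only preimages heavier than t contribute to the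
  total of \<beta>, each by the part of its rescaled mass m / t that exceeds 1.\<close>

lemma wprt_ge_capped:
  fixes \<mu> :: "('x::finite \<times> 'y::finite) pmf" and f :: "'x \<times> 'y \<Rightarrow> 'z::finite"
  assumes "0 < t" and "0 < \<epsilon>"
  shows "(1 - \<epsilon>) / t - (\<Sum>c\<in>UNIV. max 0 (measure_pmf.prob \<mu> (f -` {c}) / t - 1)) \<le> wprt \<mu> \<epsilon> f"
proof -
  let ?m = "\<lambda>c. measure_pmf.prob \<mu> (f -` {c})"
  let ?\<beta> = "\<lambda>p. pmf \<mu> p * (1 / t - 1 / max t (?m (f p)))"
  have "(\<Sum>p\<in>UNIV. ?\<beta> p) = (\<Sum>c\<in>UNIV. \<Sum>p | p \<in> UNIV \<and> f p = c. ?\<beta> p)"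
    by (rule sum.group[symmetric]) auto
  also have "\<dots> = (\<Sum>c\<in>UNIV. ?m c * (1 / t - 1 / max t (?m c)))"
    by (simp add: measure_measure_pmf_finite sum_distrib_right vimage_def)
  \<comment> \<open>For mass m at most t both sides vanish; otherwise m * (1 / t - 1 / m) = m / t -
    1.\<close>
  also have "\<dots> = (\<Sum>c\<in>UNIV. max 0 (?m c / t - 1))"
    using assms by (intro sum.cong) (auto simp: max_def field_simps)
  finally have "(1 - \<epsilon>) * (1 / t) - (\<Sum>c\<in>UNIV. max 0 (?m c / t - 1)) \<in> wprt_values \<mu> \<epsilon> f"
    using wprt_feasible_capped[OF assms(1), of \<mu> f] unfolding wprt_values_def by force
  from wprt_is_max(2)[OF assms(2) this] show ?thesis by simp
qed

lemma sum_prob_enumeration: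
  fixes f :: "'x::finite \<times> 'y::finite \<Rightarrow> 'z::finite"
  assumes "decreasing_enumeration \<mu> f z"
  shows "(\<Sum>i = 1..CARD('z). measure_pmf.prob \<mu> (f -` {z i})) = 1"
proof -
  have "(\<Sum>i = 1..CARD('z). measure_pmf.prob \<mu> (f -` {z i})) = (\<Sum>c\<in>UNIV. measure_pmf.prob \<mu> (f -` {c}))"
    using assms unfolding decreasing_enumeration_def
    by (intro sum.reindex_bij_betw) auto
  also have "\<dots> = measure_pmf.prob \<mu> (\<Union>c\<in>UNIV. f -` {c})"
    by (intro measure_pmf.finite_measure_finite_Union[symmetric]) (auto simp: disjoint_family_on_def)
  also have "(\<Union>c\<in>UNIV. f -` {c}) = UNIV" by auto
  finally show ?thesis by simp
qed

theorem mainTheorem14: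
  fixes \<mu> :: "('x::finite \<times> 'y::finite) pmf"
    and f :: "'x \<times> 'y \<Rightarrow> 'z::finite"
    and z :: "nat \<Rightarrow> 'z"
    and \<epsilon> :: real
  assumes "0 < \<epsilon>" and "\<epsilon> < 1 / 2"
    and "decreasing_enumeration \<mu> f z"
  shows "real (xi \<mu> \<epsilon> f z) - 1 \<le> wprt \<mu> \<epsilon> f"
proof -
  let ?m = "\<lambda>c. measure_pmf.prob \<mu> (f -` {c})"
  let ?P = "\<lambda>j. j \<in> {1..CARD('z)} \<and> (\<Sum>i=1..j. ?m (z i)) \<ge> 1 - \<epsilon>"
  define k where "k = xi \<mu> \<epsilon> f z"
  define t where "t = ?m (z k)"
  have "?P CARD('z)"
    using sum_prob_enumeration[OF assms(3)] assms(1) by (simp add: Suc_le_eq)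
  then have k: "?P k"
    unfolding k_def xi_def by (rule LeastI)
  \<comment> \<open>For k = 1 minimality says nothing, since \<open>?P\<close> excludes 0; the sum
    is then empty and 1 - \<epsilon> is positive.\<close>
  have less: "(\<Sum>i=1..k-1. ?m (z i)) < 1 - \<epsilon>"
  proof (cases "k = 1")
    case True
    then show ?thesis using assms(2) by simp
  next
    case False
    then have "\<not> ?P (k - 1)"
      using k not_less_Least[of "k - 1" ?P] by (simp add: k_def xi_def)
    then show ?thesis using k False by auto
  qed
  have split: "(\<Sum>i=1..k. ?m (z i)) = (\<Sum>i=1..k-1. ?m (z i)) + t"
    using k sum.cl_ivl_Suc[of "\<lambda>i. ?m (z i)" 1 "k - 1"] by (simp add: t_def)
  \<comment> \<open>The partial sums cross 1 - \<epsilon> exactly when the k-th mass is added, so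
    dividing by t is legitimate.\<close>
  have t: "0 < t" using k less split by linarith
  have heavy: "t \<le> ?m (z i)" if "i \<in> {1..k}" for i
    using assms(3) k that by (auto simp: decreasing_enumeration_def t_def)
  have light: "?m (z i) \<le> t" if "i \<in> {k<..CARD('z)}" for i
    using assms(3) k that by (auto simp: decreasing_enumeration_def t_def)
  have "(\<Sum>c\<in>UNIV. max 0 (?m c / t - 1)) = (\<Sum>i = 1..CARD('z). max 0 (?m (z i) / t - 1))"
    using assms(3) unfolding decreasing_enumeration_def
    by (intro sum.reindex_bij_betw[symmetric]) auto
  \<comment> \<open>The ordering makes k the cut-off: terms after it vanish by \<open>light\<close>,
    and up to it \<open>heavy\<close> lets the maximum be dropped.\<close>
  also have "\<dots> = (\<Sum>i = 1..k. max 0 (?m (z i) / t - 1))"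
    using k light t by (intro sum.mono_neutral_right) (auto intro!: max_absorb1 simp: field_simps)
  also have "\<dots> = (\<Sum>i = 1..k. ?m (z i) / t - 1)"
    using heavy t by (intro sum.cong) (auto simp: max_def field_simps)
  also have "\<dots> = (\<Sum>i = 1..k. ?m (z i)) / t - k"
    by (simp add: sum_subtractf sum_divide_distrib)
  finally have "(1 - \<epsilon>) / t - ((\<Sum>i = 1..k. ?m (z i)) / t - k) \<le> wprt \<mu> \<epsilon> f"
    using wprt_ge_capped[OF t assms(1), of \<mu> f] by simp
  \<comment> \<open>Before the k-th mass t is added the sum is below 1 - \<epsilon>. The excess is
    thus at most t, which costs the 1 in the bound after division by t.\<close>
  moreover have "(\<Sum>i = 1..k. ?m (z i)) / t \<le> ((1 - \<epsilon>) + t) / t"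
    using less split t by (intro divide_right_mono) auto
  then have "(\<Sum>i = 1..k. ?m (z i)) / t \<le> (1 - \<epsilon>) / t + 1"
    using t by (simp add: add_divide_distrib)
  ultimately show ?thesis unfolding k_def[symmetric] by linarith
qed

end
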